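(* Let $\mathcal{N}$ be an infinite set of positive integers. Let $A$ be a set of positive integers and, for each $n\in\mathcal{N}$, let $\sigma_n$ be a random element of $\mathfrak{S}_n$, distributed according to a probability measure which is invariant under conjugation. Suppose that for all $p\geq 1$ and for all $\sigma\in\mathfrak{S}_p^{(A)}$, the probability of the event $$\{\forall m=1,\ldots,p,\ \sigma_n(m)=\sigma(m)\}$$ is asymptotic to $n^{-p}$ as $n\in\mathcal{N}$ goes to infinity. Then for any finite subset $K$ of $A$, the law of $(N_l(\sigma_n))_{l\in K}$ converges weakly, as $n\in\mathcal{N}$ goes to infinity, to $\bigotimes_{l\in K}\operatorname{Poiss}(1/l)$.
   Context: $\mathfrak{S}_n$ is the group of permutations of $\{1,\ldots,n\}$. For $A$ a set of positive integers, $\mathfrak{S}_n^{(A)}$ is the set of permutations of $\{1,\ldots,n\}$ all of whose cycles have length in $A$ (fixed points count as cycles of length $1$). A probability measure $\mathbb{P}$ on $\mathfrak{S}_n$ is invariant under conjugation if $\mathbb{P}(\{\sigma\circ\tau\circ\sigma^{-1}\})=\mathbb{P}(\{\tau\})$ for all $\sigma,\tau\in\mathfrak{S}_n$. For $\sigma\in\mathfrak{S}_n$ and $l$ a positive integer, $N_l(\sigma)$ is the number of cycles of length $l$ in the decomposition of $\sigma$ as a product of cycles with disjoint supports. For $\lambda>0$, $\operatorname{Poiss}(\lambda)$ is the Poisson distribution with mean $\lambda$. "$a_n$ is asymptotic to $b_n$" means $a_n/b_n\to 1$. *)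

theory Defs
  imports
    "HOL-Probability.Probability"
    "HOL-Combinatorics.Combinatorics"
    "HOL-Library.Landau_Symbols"
begin

definition perms :: "nat \<Rightarrow> (nat \<Rightarrow> nat) set" where
  "perms n = {\<sigma>. \<sigma> permutes {1..n}}"

text \<open>
  A cycle of \<open>\<sigma>\<close> is represented by its support, that is, by the set of points it moves around.
  A fixed point \<open>x\<close> gives the singleton \<open>{x}\<close>, so it counts as a cycle of length 1, and the
  length of a cycle is the cardinality of its support.
\<close>

definition cycle_supports :: "nat \<Rightarrow> (nat \<Rightarrow> nat) \<Rightarrow> nat set set" where
  "cycle_supports n \<sigma> = {C. C \<subseteq> {1..n} \<and> cyclic_on \<sigma> C}"

definition num_cycles :: "nat \<Rightarrow> nat \<Rightarrow> (nat \<Rightarrow> nat) \<Rightarrow> nat" where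
  "num_cycles n l \<sigma> = card {C \<in> cycle_supports n \<sigma>. card C = l}"

definition perms_cycles_in :: "nat \<Rightarrow> nat set \<Rightarrow> (nat \<Rightarrow> nat) set" where
  "perms_cycles_in n A = {\<sigma> \<in> perms n. \<forall>C \<in> cycle_supports n \<sigma>. card C \<in> A}"

definition conjugation_invariant :: "nat \<Rightarrow> (nat \<Rightarrow> nat) measure \<Rightarrow> bool" where
  "conjugation_invariant n P \<longleftrightarrow>
    (\<forall>\<sigma> \<in> perms n. \<forall>\<tau> \<in> perms n. measure P {\<sigma> \<circ> \<tau> \<circ> inv \<sigma>} = measure P {\<tau>})"

text \<open>
  Weak convergence, along a filter, of measures on a topological space. The measures are meant
  to have a \<open>\<sigma>\<close>-algebra for which every bounded continuous function is measurable, since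
  the Bochner integral of a non-measurable function is 0 by convention.
\<close>

definition weakly_converges ::
    "'a topology \<Rightarrow> ('i \<Rightarrow> 'a measure) \<Rightarrow> 'a measure \<Rightarrow> 'i filter \<Rightarrow> bool" where
  "weakly_converges T \<mu> \<nu> F \<longleftrightarrow>
    (\<forall>f :: 'a \<Rightarrow> real. continuous_map T euclidean f \<and> bounded (f ` topspace T) \<longrightarrow>
      ((\<lambda>n. \<integral>x. f x \<partial>\<mu> n) \<longlongrightarrow> (\<integral>x. f x \<partial>\<nu>)) F)"

text \<open>
  The space of vectors \<open>(k\<^sub>l)\<^sub>l\<^sub>\<in>\<^sub>K\<close> of natural numbers. For finite \<open>K\<close> it is countable and discrete,
  and its \<open>\<sigma>\<close>-algebra contains all subsets, so every real function on it is measurable.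
\<close>

abbreviation nat_vectors :: "'k set \<Rightarrow> ('k \<Rightarrow> nat) measure" where
  "nat_vectors K \<equiv> \<Pi>\<^sub>M l\<in>K. count_space UNIV"

abbreviation nat_vectors_topology :: "'k set \<Rightarrow> ('k \<Rightarrow> nat) topology" where
  "nat_vectors_topology K \<equiv> product_topology (\<lambda>l. euclidean) K"

lemma sets_nat_vectors:
  assumes "finite K"
  shows "sets (nat_vectors K) = Pow (topspace (nat_vectors_topology K))"
  using assms by (simp add: count_space_PiM_finite)

end

theory Submission
  imports Defs
begin

text \<open>
  The proof is by the method of moments. Let \<open>\<tau>\<close> be a permutation of \<open>{1..p}\<close> with
  \<open>m l\<close> cycles of length \<open>l\<close> for each \<open>l \<in> K\<close>. An injection \<open>f\<close> from \<open>{1..p}\<close> to \<open>{1..n}\<close> with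
  \<open>\<sigma> \<circ> f = f \<circ> \<tau>\<close> sends the cycles of \<open>\<tau>\<close> to distinct cycles of \<open>\<sigma>\<close> of the same length, with a free
  choice of base point on each, so there are exactly
  \<open>\<Prod>l\<in>K. l ^ m l * fact (m l) * (N\<^sub>l(\<sigma>) choose m l)\<close> of them. By conjugation invariance
  every \<open>f\<close> satisfies the equation with the probability that \<open>\<sigma>\<^sub>n\<close> agrees with \<open>\<tau>\<close> on \<open>{1..p}\<close>; since
  there are about \<open>n ^ p\<close> injections, the expected number of solutions tends to 1. The
  joint binomial moments of the cycle counts therefore tend to those of independent Poisson
  variables, and Bonferroni inequalities turn this into convergence of all point masses.
\<close>

section \<open>Equivariant injections and cycle counts\<close>

text \<open>Embeddings of the dynamical system (\<open>T\<close>, \<open>\<tau>\<close>) into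
  (\<open>S\<close>, \<open>\<sigma>\<close>). The functions are extensional, so each is determined
  by its values on \<open>T\<close> and the set can be counted.\<close>

definition equivariant_injections ::
    "'a set \<Rightarrow> ('a \<Rightarrow> 'a) \<Rightarrow> 'b set \<Rightarrow> ('b \<Rightarrow> 'b) \<Rightarrow> ('a \<Rightarrow> 'b) set" where
  "equivariant_injections T \<tau> S \<sigma> =
    {f \<in> T \<rightarrow>\<^sub>E S. inj_on f T \<and> (\<forall>t\<in>T. \<sigma> (f t) = f (\<tau> t))}"

text \<open>Points are collected instead of cycles because extending an embedding by an
  \<open>l\<close>-cycle amounts to choosing a base point. For a permutation of a finite set,
  \<open>orbit \<sigma> x\<close> is the support of the cycle through \<open>x\<close>.\<close>

definition points_on_cycles :: "'a set \<Rightarrow> ('a \<Rightarrow> 'a) \<Rightarrow> nat \<Rightarrow> 'a set" where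
  "points_on_cycles S \<sigma> l = {x \<in> S. card (orbit \<sigma> x) = l}"

lemma permutes_self_in_orbit: "\<sigma> permutes S \<Longrightarrow> finite S \<Longrightarrow> x \<in> orbit \<sigma> x"
  by (rule permutation_self_in_orbit) (auto simp: permutation_permutes)

lemma cycle_supports_eq_orbits:
  assumes "\<sigma> \<in> perms n"
  shows "cycle_supports n \<sigma> = orbit \<sigma> ` {1..n}"
proof -
  have \<sigma>: "\<sigma> permutes {1..n}" using assms by (simp add: perms_def)
  show ?thesis
  proof (intro set_eqI iffI)
    fix C assume "C \<in> cycle_supports n \<sigma>"
    then show "C \<in> orbit \<sigma> ` {1..n}"
      by (auto simp: cycle_supports_def cyclic_on_def)
  next
    fix C assume "C \<in> orbit \<sigma> ` {1..n}"
    then show "C \<in> cycle_supports n \<sigma>"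
      using cyclic_on_orbit[OF \<sigma>] permutes_orbit_subset[OF \<sigma>]
      unfolding cycle_supports_def by blast
  qed
qed

text \<open>Two cyclic supports sharing a point are both the orbit of that point, so the supports of
  the \<open>l\<close>-cycles partition these points into blocks of size \<open>l\<close>.\<close>

lemma card_points_on_cycles:
  assumes "\<sigma> \<in> perms n"
  shows "card (points_on_cycles {1..n} \<sigma> l) = l * num_cycles n l \<sigma>"
proof -
  have \<sigma>: "\<sigma> permutes {1..n}" using assms by (simp add: perms_def)
  let ?\<C> = "{C \<in> cycle_supports n \<sigma>. card C = l}"
  have "points_on_cycles {1..n} \<sigma> l = \<Union> ?\<C>"
  proof (intro set_eqI iffI)
    fix x assume "x \<in> points_on_cycles {1..n} \<sigma> l"
    then show "x \<in> \<Union> ?\<C>"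
      using permutes_self_in_orbit[OF \<sigma>, of x]
      by (auto simp: points_on_cycles_def cycle_supports_eq_orbits[OF assms])
  next
    fix x assume "x \<in> \<Union> ?\<C>"
    then show "x \<in> points_on_cycles {1..n} \<sigma> l"
      by (auto simp: points_on_cycles_def cycle_supports_def dest: orbit_cyclic_eq3)
  qed
  moreover have "l * card ?\<C> = card (\<Union> ?\<C>)"
  proof (rule card_partition)
    show "finite ?\<C>" by (simp add: cycle_supports_eq_orbits[OF assms])
    show "finite (\<Union> ?\<C>)"
      by (rule finite_subset[of _ "{1..n}"]) (auto simp: cycle_supports_def)
    fix C D assume "C \<in> ?\<C>" "D \<in> ?\<C>" "C \<noteq> D"
    then show "C \<inter> D = {}" by (auto simp: cycle_supports_def dest: orbit_cyclic_eq3)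
  qed simp
  ultimately show ?thesis by (simp add: num_cycles_def)
qed

text \<open>Equivariance carries the orbit of \<open>t\<close> onto the orbit of \<open>f t\<close>,
  and injectivity keeps its size; hence \<open>f\<close> preserves cycle lengths.\<close>

lemma equivariant_image_points_on_cycles:
  assumes "finite T" "\<tau> permutes T" "f \<in> equivariant_injections T \<tau> S \<sigma>"
  shows "points_on_cycles S \<sigma> l \<inter> f ` T = f ` points_on_cycles T \<tau> l"
proof -
  have "card (orbit \<sigma> (f t)) = card (orbit \<tau> t)" if "t \<in> T" for t
  proof -
    have sub: "orbit \<tau> t \<subseteq> T" using permutes_orbit_subset[OF assms(2) that] .
    have "f ` orbit \<tau> t = orbit \<sigma> (f t)"
      using assms(3) sub
      by (intro orbit_inverse permutes_self_in_orbit[OF assms(2,1)])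
        (auto simp: equivariant_injections_def)
    moreover have "inj_on f (orbit \<tau> t)"
      using assms(3) sub by (auto simp: equivariant_injections_def intro: inj_on_subset)
    ultimately show ?thesis using card_image by metis
  qed
  then show ?thesis
    using assms(3) by (auto simp: points_on_cycles_def equivariant_injections_def)
qed

section \<open>Appending one cycle to a permutation\<close>

text \<open>The cycle (p+1, p+2, ..., p+l) is put on the next free integers, so that a permutation
  with prescribed cycle counts can be built one cycle at a time. The second branch closes the cycle;
  for \<open>l = 1\<close> it alone acts and makes \<open>p + 1\<close> a fixed point.\<close>

definition add_cycle :: "nat \<Rightarrow> nat \<Rightarrow> (nat \<Rightarrow> nat) \<Rightarrow> nat \<Rightarrow> nat" where
  "add_cycle p l \<sigma> m =
    (if p < m \<and> m < p + l then m + 1 else if p < m \<and> m = p + l then p + 1 else \<sigma> m)"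

text \<open>Old points stay at most \<open>p\<close> and new points stay above \<open>p\<close>, so
  injectivity can be checked on each block; finiteness then gives bijectivity.\<close>

lemma add_cycle_in_perms:
  assumes "\<sigma> \<in> perms p" "l \<ge> 1"
  shows "add_cycle p l \<sigma> \<in> perms (p + l)"
proof -
  have \<sigma>: "\<sigma> permutes {1..p}" using assms by (simp add: perms_def)
  have in_iff: "\<sigma> m \<in> {1..p} \<longleftrightarrow> m \<in> {1..p}" for m by (rule permutes_in_image[OF \<sigma>])
  have out: "\<sigma> m = m" if "m \<notin> {1..p}" for m using permutes_not_in[OF \<sigma> that] .
  have inj: "\<sigma> x = \<sigma> y \<longleftrightarrow> x = y" for x y
    using permutes_inj[OF \<sigma>] by (auto dest: injD)
  have le: "\<sigma> m \<le> p \<longleftrightarrow> m \<le> p" for m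
    using in_iff[of m] out[of m] by (cases "m \<in> {1..p}") auto
  have "inj_on (add_cycle p l \<sigma>) {1..p+l}"
  proof (rule inj_onI)
    fix x y assume *: "x \<in> {1..p+l}" "y \<in> {1..p+l}" "add_cycle p l \<sigma> x = add_cycle p l \<sigma> y"
    have old: "add_cycle p l \<sigma> m = \<sigma> m \<and> \<sigma> m \<le> p" if "m \<le> p" for m
      using that le[of m] by (simp add: add_cycle_def)
    have new: "add_cycle p l \<sigma> m = (if m = p + l then p + 1 else m + 1)"
      if "p < m" "m \<le> p + l" for m
      using that by (auto simp: add_cycle_def)
    consider "x \<le> p" "y \<le> p" | "x \<le> p" "p < y" | "p < x" "y \<le> p" | "p < x" "p < y"
      by linarith
    then show "x = y"
    proof cases
      case 1 then show ?thesis using *(3) old[of x] old[of y] inj[of x y] by simp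
    next
      case 2 then show ?thesis using * old[of x] new[of y] by (simp split: if_splits)
    next
      case 3 then show ?thesis using * old[of y] new[of x] by (simp split: if_splits)
    next
      case 4 then show ?thesis using * new[of x] new[of y] by (simp split: if_splits)
    qed
  qed
  moreover have "add_cycle p l \<sigma> ` {1..p+l} \<subseteq> {1..p+l}"
  proof -
    have "add_cycle p l \<sigma> m \<in> {1..p+l}" if "m \<in> {1..p+l}" for m
      using that in_iff[of m] assms(2) unfolding add_cycle_def by (auto split: if_splits)
    then show ?thesis by blast
  qed
  ultimately have "bij_betw (add_cycle p l \<sigma>) {1..p+l} {1..p+l}"
    by (simp add: bij_betw_def endo_inj_surj)
  moreover have "add_cycle p l \<sigma> x = x" if "x \<notin> {1..p+l}" for x
    using that out[of x] by (auto simp: add_cycle_def)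
  ultimately show ?thesis unfolding perms_def by (auto intro: bij_imp_permutes)
qed

lemma add_cycle_funpow:
  "i < l \<Longrightarrow> (add_cycle p l \<sigma> ^^ i) (p + 1) = p + 1 + i"
  by (induction i) (auto simp: add_cycle_def)

lemma orbit_add_cycle_new:
  assumes "\<sigma> \<in> perms p" "x \<in> {p+1..p+l}"
  shows "orbit (add_cycle p l \<sigma>) x = {p+1..p+l}"
proof -
  let ?\<sigma>' = "add_cycle p l \<sigma>"
  have l: "l \<ge> 1" using assms(2) by simp
  \<comment> \<open>After \<open>l - 1\<close> steps the iterate is at \<open>p + l\<close>, and the
    next application takes the closing branch back to \<open>p + 1\<close>.\<close>
  have "(?\<sigma>' ^^ l) (p + 1) = p + 1"
    using add_cycle_funpow[of "l - 1" l p \<sigma>] l by (cases l) (auto simp: add_cycle_def)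
  then have "orbit ?\<sigma>' (p + 1) = {(?\<sigma>' ^^ i) (p + 1) | i. i < l}"
    using l by (intro orbit_altdef_bounded) auto
  also have "\<dots> = {p + 1 + i | i. i < l}"
    using add_cycle_funpow[of _ l p \<sigma>] by metis
  also have "\<dots> = {p+1..p+l}"
  proof (intro set_eqI iffI)
    fix y assume "y \<in> {p+1..p+l}"
    then show "y \<in> {p + 1 + i | i. i < l}" by (intro CollectI exI[of _ "y - p - 1"]) auto
  qed auto
  finally have "cyclic_on ?\<sigma>' {p+1..p+l}"
    using l by (intro cyclic_on_singleI[of "p + 1"]) auto
  then show ?thesis using orbit_cyclic_eq3 assms(2) by metis
qed

lemma orbit_add_cycle_old:
  assumes "\<sigma> \<in> perms p" "x \<in> {1..p}"
  shows "orbit (add_cycle p l \<sigma>) x = orbit \<sigma> x"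
proof (rule orbit_cong0[symmetric])
  show "\<sigma> \<in> {1..p} \<rightarrow> {1..p}" using assms(1) permutes_in_image by (fastforce simp: perms_def)
qed (use assms(2) in \<open>auto simp: add_cycle_def\<close>)

lemma points_on_cycles_add_cycle:
  assumes "\<sigma> \<in> perms p"
  shows "card (points_on_cycles {1..p+l} (add_cycle p l \<sigma>) j) =
    card (points_on_cycles {1..p} \<sigma> j) + (if j = l then l else 0)"
proof -
  have split: "{1..p+l} = {1..p} \<union> {p+1..p+l}" by auto
  have "points_on_cycles {1..p+l} (add_cycle p l \<sigma>) j =
      points_on_cycles {1..p} \<sigma> j \<union> (if j = l then {p+1..p+l} else {})"
    unfolding points_on_cycles_def split
    using orbit_add_cycle_old[OF assms, of _ l] orbit_add_cycle_new[OF assms, of _ l]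
    by auto
  moreover have "points_on_cycles {1..p} \<sigma> j \<inter> {p+1..p+l} = {}"
    by (auto simp: points_on_cycles_def)
  moreover have "finite (points_on_cycles {1..p} \<sigma> j)" by (simp add: points_on_cycles_def)
  ultimately show ?thesis by (cases "j = l") (simp_all add: card_Un_disjoint)
qed

text \<open>An equivariant injection is determined on a new \<open>l\<close>-cycle by the image of one point, which
  can be any point that lies on an \<open>l\<close>-cycle of \<open>\<sigma>\<close> not yet hit.\<close>

lemma bij_betw_equivariant_injections_add_cycle:
  assumes \<tau>: "\<tau> \<in> perms p" and l: "l \<ge> 1" and \<sigma>: "\<sigma> permutes S" "finite S"
  shows "bij_betw (\<lambda>f. (restrict f {1..p}, f (p + 1)))
    (equivariant_injections {1..p+l} (add_cycle p l \<tau>) S \<sigma>)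
    (SIGMA f : equivariant_injections {1..p} \<tau> S \<sigma>. points_on_cycles S \<sigma> l - f ` {1..p})"
    (is "bij_betw ?\<Phi> ?E' ?R")
proof -
  let ?\<tau>' = "add_cycle p l \<tau>"
  \<comment> \<open>The base point \<open>x\<close> is the image of \<open>p + 1\<close>, and
    \<open>m\<close> lies \<open>m - p - 1\<close> steps further along the new cycle, so
    equivariance forces this formula.\<close>
  let ?\<Psi> = "\<lambda>(f, x). \<lambda>m\<in>{1..p+l}. if m \<le> p then f m else (\<sigma> ^^ (m - p - 1)) x"
  have \<tau>p: "\<tau> permutes {1..p}" using \<tau> by (simp add: perms_def)
  have \<tau>'p: "?\<tau>' permutes {1..p+l}" using add_cycle_in_perms[OF \<tau> l] by (simp add: perms_def)
  have \<tau>_in: "\<tau> m \<in> {1..p}" if "m \<in> {1..p}" for m using that permutes_in_image[OF \<tau>p] by blast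
  have \<tau>'_old: "?\<tau>' m = \<tau> m" if "m \<le> p" for m using that by (simp add: add_cycle_def)
  have fwd: "?\<Phi> f \<in> ?R" if f: "f \<in> ?E'" for f
  proof -
    have fE: "f \<in> {1..p+l} \<rightarrow> S" "inj_on f {1..p+l}"
      and eq: "\<And>t. t \<in> {1..p+l} \<Longrightarrow> \<sigma> (f t) = f (?\<tau>' t)"
      using f by (auto simp: equivariant_injections_def)
    have "restrict f {1..p} \<in> equivariant_injections {1..p} \<tau> S \<sigma>"
    proof -
      have "inj_on f {1..p}" using fE(2) by (rule inj_on_subset) auto
      moreover have "\<sigma> (f t) = f (\<tau> t)" if "t \<in> {1..p}" for t
        using eq[of t] \<tau>'_old[of t] that by auto
      ultimately show ?thesis
        using fE(1) \<tau>_in by (auto simp: equivariant_injections_def)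
    qed
    moreover have "f (p + 1) \<in> points_on_cycles S \<sigma> l"
    proof -
      have "p + 1 \<in> points_on_cycles {1..p+l} ?\<tau>' l"
        using orbit_add_cycle_new[OF \<tau>, of "p+1" l] l by (auto simp: points_on_cycles_def)
      then show ?thesis
        using equivariant_image_points_on_cycles[OF _ \<tau>'p f, of l] by auto
    qed
    moreover have "f (p + 1) \<notin> f ` {1..p}"
      using inj_on_image_mem_iff[OF fE(2), of "p+1" "{1..p}"] l by auto
    ultimately show ?thesis by auto
  qed
  have funpow: "f (p + 1 + i) = (\<sigma> ^^ i) (f (p + 1))" if f: "f \<in> ?E'" and "i < l" for f i
    using that(2)
  proof (induction i)
    case (Suc i)
    have "\<sigma> (f (p + 1 + i)) = f (?\<tau>' (p + 1 + i))"
      using f Suc.prems by (auto simp: equivariant_injections_def)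
    also have "?\<tau>' (p + 1 + i) = p + 1 + Suc i" using Suc.prems by (simp add: add_cycle_def)
    finally show ?case using Suc by simp
  qed simp
  have bwd: "?\<Psi> y \<in> ?E'" if "y \<in> ?R" for y
  proof -
    obtain f x where y: "y = (f, x)" by (cases y)
    have f: "f \<in> {1..p} \<rightarrow> S" "inj_on f {1..p}" "\<And>t. t \<in> {1..p} \<Longrightarrow> \<sigma> (f t) = f (\<tau> t)"
      using that y by (auto simp: equivariant_injections_def)
    have x: "x \<in> S" "card (orbit \<sigma> x) = l" "x \<notin> f ` {1..p}"
      using that y by (auto simp: points_on_cycles_def)
    have self: "x \<in> orbit \<sigma> x" using permutes_self_in_orbit[OF \<sigma>] .
    have orb: "orbit \<sigma> x = (\<lambda>i. (\<sigma> ^^ i) x) ` {0..<funpow_dist1 \<sigma> x x}"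
      using orbit_conv_funpow_dist1[OF self] by simp
    have inj: "inj_on (\<lambda>i. (\<sigma> ^^ i) x) {0..<funpow_dist1 \<sigma> x x}"
      using inj_on_funpow_dist1[OF self] .
    \<comment> \<open>The orbit is enumerated without repetition up to the first return time, so
      that time equals the orbit size \<open>l\<close>.\<close>
    have dist: "funpow_dist1 \<sigma> x x = l" using x(2) card_image[OF inj] orb by simp
    have per: "(\<sigma> ^^ l) x = x" using funpow_dist1_prop[OF self] dist by simp
    have inS: "(\<sigma> ^^ i) x \<in> S" for i
      using permutes_orbit_subset[OF \<sigma>(1) x(1)] funpow_in_orbit[OF self] by blast
    have f_inv: "(\<sigma> ^^ i) (f t) \<in> f ` {1..p}" if "t \<in> {1..p}" for i t
    proof (induction i)
      case (Suc i)
      then obtain u where u: "u \<in> {1..p}" "(\<sigma> ^^ i) (f t) = f u" by blast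
      then have "(\<sigma> ^^ Suc i) (f t) = f (\<tau> u)" using f(3)[of u] by simp
      then show ?case using \<tau>_in[OF u(1)] by blast
    qed (use that in auto)
    \<comment> \<open>The image of \<open>f\<close> is stable under \<open>\<sigma>\<close>. If an
      iterate of \<open>x\<close> met it, following the cycle around to \<open>x\<close> would put
      \<open>x\<close> in the image as well.\<close>
    have disj: "(\<sigma> ^^ i) x \<noteq> f t" if "t \<in> {1..p}" for i t
    proof
      assume *: "(\<sigma> ^^ i) x = f t"
      have "x \<in> orbit \<sigma> ((\<sigma> ^^ i) x)"
        using orbit_swap[OF self] funpow_in_orbit[OF self] by blast
      then obtain j where "x = (\<sigma> ^^ j) (f t)" unfolding * by (auto simp: orbit_altdef)
      with f_inv[OF that] x(3) show False by metis
    qed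
    let ?g = "\<lambda>m. if m \<le> p then f m else (\<sigma> ^^ (m - p - 1)) x"
    have "inj_on ?g {1..p+l}"
    proof (rule inj_onI)
      fix a b assume ab: "a \<in> {1..p+l}" "b \<in> {1..p+l}" and eq: "?g a = ?g b"
      consider "a \<le> p" "b \<le> p" | "a \<le> p" "b > p" | "a > p" "b \<le> p" | "a > p" "b > p"
        by linarith
      then show "a = b"
      proof cases
        case 1 then show ?thesis using eq ab f(2) by (auto dest: inj_onD)
      next
        case 2 then show ?thesis using eq ab disj[of a "b - p - 1"] by auto
      next
        case 3 then show ?thesis using eq ab disj[of b "a - p - 1"] by auto
      next
        case 4
        then have "a - p - 1 = b - p - 1"
          using eq ab inj_onD[OF inj, of "a - p - 1" "b - p - 1"] unfolding dist by auto
        then show ?thesis using 4 by simp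
      qed
    qed
    moreover have "\<sigma> (?g t) = ?g (?\<tau>' t) \<and> ?\<tau>' t \<in> {1..p+l}" if t: "t \<in> {1..p+l}" for t
    proof (cases "t \<le> p")
      case True
      then show ?thesis using t f(3)[of t] \<tau>_in[of t] by (auto simp: \<tau>'_old)
    next
      case False
      show ?thesis
      proof (cases "t = p + l")
        case True
        \<comment> \<open>At the closing point \<open>p + l\<close>, one more application of
          \<open>\<sigma>\<close> must lead back to the base point; this holds because
          \<open>x\<close> has period \<open>l\<close>.\<close>
        have "\<sigma> ((\<sigma> ^^ (l - 1)) x) = x" using per l by (cases l) auto
        then show ?thesis using True l by (auto simp: add_cycle_def)
      next
        case False
        then have "\<sigma> ((\<sigma> ^^ (t - p - 1)) x) = (\<sigma> ^^ (t - p)) x"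
          using \<open>\<not> t \<le> p\<close> by (cases "t - p") (auto simp: diff_Suc)
        then show ?thesis using False \<open>\<not> t \<le> p\<close> t by (auto simp: add_cycle_def)
      qed
    qed
    moreover have "?g t \<in> S" if "t \<in> {1..p+l}" for t using that f(1) inS by auto
    ultimately show ?thesis unfolding y equivariant_injections_def by (auto cong: if_cong)
  qed
  show ?thesis
  proof (rule bij_betw_byWitness[where f' = ?\<Psi>])
    show "\<forall>f\<in>?E'. ?\<Psi> (?\<Phi> f) = f"
    proof
      fix f assume f: "f \<in> ?E'"
      have "?\<Psi> (?\<Phi> f) m = f m" for m
      proof (cases "m \<in> {1..p+l}")
        case True
        show ?thesis
        proof (cases "m \<le> p")
          case False
          then have "p + 1 + (m - p - 1) = m" "m - p - 1 < l" using True by auto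
          then have "f m = (\<sigma> ^^ (m - p - 1)) (f (p + 1))"
            using funpow[OF f, of "m - p - 1"] by metis
          then show ?thesis using True False by (simp only: restrict_apply prod.case if_True if_False)
        qed (use True in simp)
      next
        case False
        have "f \<in> {1..p+l} \<rightarrow>\<^sub>E S" using f by (simp add: equivariant_injections_def)
        then have "f m = undefined" using False by (rule PiE_arb)
        then show ?thesis by (simp only: restrict_apply prod.case False if_False)
      qed
      then show "?\<Psi> (?\<Phi> f) = f" by blast
    qed
    show "\<forall>y\<in>?R. ?\<Phi> (?\<Psi> y) = y"
    proof
      fix y assume "y \<in> ?R"
      then obtain f x where y: "y = (f, x)" and f: "f \<in> {1..p} \<rightarrow>\<^sub>E S"
        by (auto simp: equivariant_injections_def)
      have "restrict (?\<Psi> (f, x)) {1..p} m = f m" for m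
      proof (cases "m \<in> {1..p}")
        case False
        then show ?thesis using PiE_arb[OF f False] by (simp only: restrict_apply if_False)
      qed simp
      then have "restrict (?\<Psi> (f, x)) {1..p} = f" by blast
      moreover have "?\<Psi> (f, x) (p + 1) = x" using l by simp
      ultimately show "?\<Phi> (?\<Psi> y) = y" unfolding y by (simp only:)
    qed
    show "?\<Phi> ` ?E' \<subseteq> ?R" using fwd by blast
    show "?\<Psi> ` ?R \<subseteq> ?E'" using bwd by blast
  qed
qed

section \<open>Counting equivariant injections\<close>

lemma finite_equivariant_injections:
  "finite T \<Longrightarrow> finite S \<Longrightarrow> finite (equivariant_injections T \<tau> S \<sigma>)"
  by (rule finite_subset[of _ "T \<rightarrow>\<^sub>E S"]) (auto simp: equivariant_injections_def intro: finite_PiE)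

text \<open>Every \<open>f\<close> occupies exactly as many points on \<open>l\<close>-cycles of
  \<open>\<sigma>\<close> as \<open>\<tau>\<close> has, so all of them leave equally many base
  points free. When the subtraction truncates, there is no \<open>f\<close> and both sides are
  0.\<close>

lemma card_equivariant_injections_add_cycle:
  assumes \<tau>: "\<tau> \<in> perms p" and l: "l \<ge> 1" and \<sigma>: "\<sigma> permutes S" "finite S"
  shows "card (equivariant_injections {1..p+l} (add_cycle p l \<tau>) S \<sigma>) =
    card (equivariant_injections {1..p} \<tau> S \<sigma>) *
      (card (points_on_cycles S \<sigma> l) - card (points_on_cycles {1..p} \<tau> l))"
proof -
  have \<tau>p: "\<tau> permutes {1..p}" using \<tau> by (simp add: perms_def)
  have fin: "finite (points_on_cycles S \<sigma> l)" using \<sigma>(2) by (simp add: points_on_cycles_def)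
  have "card (points_on_cycles S \<sigma> l - f ` {1..p}) =
      card (points_on_cycles S \<sigma> l) - card (points_on_cycles {1..p} \<tau> l)"
    if f: "f \<in> equivariant_injections {1..p} \<tau> S \<sigma>" for f
  proof -
    have "inj_on f (points_on_cycles {1..p} \<tau> l)"
      using f by (auto simp: equivariant_injections_def points_on_cycles_def intro: inj_on_subset)
    then show ?thesis
      using equivariant_image_points_on_cycles[OF finite_atLeastAtMost \<tau>p f, of l]
        card_Diff_subset_Int[OF finite_Int[OF disjI1[OF fin]], of "f ` {1..p}"]
      by (simp only: card_image)
  qed
  then show ?thesis
    using bij_betw_same_card[OF bij_betw_equivariant_injections_add_cycle[OF assms]]
    by (simp add: finite_equivariant_injections \<sigma>(2) fin)
qed

text \<open>Induction on the total number of cycles, each step appending one with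
  \<open>add_cycle\<close>. The middle conjunct supplies the number of points to subtract in the
  extension count.\<close>

lemma exists_perm_with_cycle_counts:
  assumes "finite K" "\<forall>l\<in>K. l \<ge> 1"
  shows "\<exists>\<tau> \<in> perms_cycles_in (\<Sum>l\<in>K. l * m l) K.
    (\<forall>j\<in>K. card (points_on_cycles {1..\<Sum>l\<in>K. l * m l} \<tau> j) = j * m j) \<and>
    (\<forall>n. \<forall>\<sigma>\<in>perms n. card (equivariant_injections {1..\<Sum>l\<in>K. l * m l} \<tau> {1..n} \<sigma>) =
      (\<Prod>l\<in>K. l ^ m l * fact (m l) * (num_cycles n l \<sigma> choose m l)))"
proof (induction "\<Sum>l\<in>K. m l" arbitrary: m)
  case 0
  then have m: "\<forall>l\<in>K. m l = 0" using assms(1) by simp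
  have "id \<in> perms_cycles_in 0 K"
    by (auto simp: perms_cycles_in_def perms_def cycle_supports_def cyclic_on_def permutes_id)
  \<comment> \<open>On the empty domain the only equivariant injection is the empty function, which
    matches a product of ones.\<close>
  moreover have "equivariant_injections {} \<tau> {1..n} \<sigma> = {\<lambda>_. undefined}"
    for \<sigma> \<tau> :: "nat \<Rightarrow> nat" and n
    by (auto simp: equivariant_injections_def)
  ultimately show ?case using m by (intro bexI[of _ id]) (auto simp: points_on_cycles_def)
next
  case (Suc s)
  then have "(\<Sum>l\<in>K. m l) \<noteq> 0" by simp
  then obtain l where l: "l \<in> K" "m l > 0" using assms(1) by auto
  \<comment> \<open>One cycle of a length \<open>l\<close> that occurs is removed;
    \<open>m l > 0\<close> makes the natural subtraction exact.\<close>
  define m' where "m' = m(l := m l - 1)"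
  have "s = (\<Sum>j\<in>K. m' j)"
    using Suc(2) l assms(1) by (simp add: sum.remove[of K l] m'_def)
  define p where "p = (\<Sum>j\<in>K. j * m' j)"
  from Suc(1)[OF \<open>s = _\<close>] obtain \<tau> where \<tau>: "\<tau> \<in> perms_cycles_in p K"
    and pts: "\<And>j. j \<in> K \<Longrightarrow> card (points_on_cycles {1..p} \<tau> j) = j * m' j"
    and cnt: "\<And>n \<sigma>. \<sigma> \<in> perms n \<Longrightarrow> card (equivariant_injections {1..p} \<tau> {1..n} \<sigma>) =
      (\<Prod>l\<in>K. l ^ m' l * fact (m' l) * (num_cycles n l \<sigma> choose m' l))"
    unfolding p_def by blast
  have \<tau>p: "\<tau> \<in> perms p" using \<tau> by (simp add: perms_cycles_in_def)
  have l1: "l \<ge> 1" using assms(2) l(1) by blast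
  have sum_eq: "(\<Sum>j\<in>K. j * m j) = p + l"
  proof -
    have "(\<Sum>j\<in>K. j * m j) = l * m l + (\<Sum>j\<in>K - {l}. j * m j)"
      using assms(1) l(1) by (simp add: sum.remove)
    moreover have "p = l * (m l - 1) + (\<Sum>j\<in>K - {l}. j * m j)"
      unfolding p_def using assms(1) l(1) by (simp add: sum.remove m'_def)
    moreover have "l * m l = l * (m l - 1) + l" using l(2) by (cases "m l") auto
    ultimately show ?thesis by simp
  qed
  let ?\<tau>' = "add_cycle p l \<tau>"
  have \<tau>': "?\<tau>' \<in> perms (p + l)" using add_cycle_in_perms[OF \<tau>p l1] .
  have "?\<tau>' \<in> perms_cycles_in (p + l) K"
  proof -
    have "card (orbit ?\<tau>' x) \<in> K" if "x \<in> {1..p+l}" for x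
    proof (cases "x \<le> p")
      case True
      then have "orbit \<tau> x \<in> cycle_supports p \<tau>"
        using that by (simp add: cycle_supports_eq_orbits[OF \<tau>p])
      then show ?thesis
        using \<tau> that True orbit_add_cycle_old[OF \<tau>p, of x l] by (simp add: perms_cycles_in_def)
    next
      case False
      then show ?thesis using orbit_add_cycle_new[OF \<tau>p, of x l] that l(1) by simp
    qed
    then show ?thesis using \<tau>' by (auto simp: perms_cycles_in_def cycle_supports_eq_orbits)
  qed
  moreover have "card (points_on_cycles {1..p+l} ?\<tau>' j) = j * m j" if "j \<in> K" for j
    using points_on_cycles_add_cycle[OF \<tau>p, of l j] pts[OF that] l(2)
    by (cases "m l") (auto simp: m'_def)
  moreover have "card (equivariant_injections {1..p+l} ?\<tau>' {1..n} \<sigma>) =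
      (\<Prod>l\<in>K. l ^ m l * fact (m l) * (num_cycles n l \<sigma> choose m l))"
    if \<sigma>: "\<sigma> \<in> perms n" for n \<sigma>
  proof -
    let ?N = "num_cycles n l \<sigma>"
    let ?h = "\<lambda>j k. j ^ k * fact k * (num_cycles n j \<sigma> choose k)"
    obtain k where k: "m l = Suc k" using l(2) gr0_implies_Suc by blast
    have "card (equivariant_injections {1..p+l} ?\<tau>' {1..n} \<sigma>) =
        (\<Prod>j\<in>K. ?h j (m' j)) * (l * ?N - l * m' l)"
      using card_equivariant_injections_add_cycle[OF \<tau>p l1, of \<sigma> "{1..n}"] \<sigma>
        cnt[OF \<sigma>] pts[OF l(1)] card_points_on_cycles[OF \<sigma>, of l]
      by (simp add: perms_def)
    also have "\<dots> = (?h l k * (l * ?N - l * k)) * (\<Prod>j\<in>K - {l}. ?h j (m j))"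
      using assms(1) l(1) by (simp add: prod.remove m'_def k)
    also have "?h l k * (l * ?N - l * k) = l ^ Suc k * fact k * ((?N - k) * (?N choose k))"
      by (simp add: algebra_simps diff_mult_distrib2)
    also have "(?N - k) * (?N choose k) = Suc k * (?N choose Suc k)"
      by (simp only: binomial_absorb_comp binomial_absorption)
    also have "l ^ Suc k * fact k * (Suc k * (?N choose Suc k)) = ?h l (m l)"
      by (simp add: k algebra_simps)
    also have "\<dots> * (\<Prod>j\<in>K - {l}. ?h j (m j)) = (\<Prod>j\<in>K. ?h j (m j))"
      using assms(1) l(1) by (simp add: prod.remove)
    finally show ?thesis .
  qed
  ultimately show ?case unfolding sum_eq by (intro bexI[of _ ?\<tau>']) auto
qed

section \<open>Binomial moments of the cycle counts\<close>

text \<open>The complements of \<open>T\<close> and of its image in \<open>S\<close> have equal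
  size, so any bijection between them completes \<open>f\<close>.\<close>

lemma inj_on_extends_to_permutation:
  assumes "finite S" "T \<subseteq> S" "f ` T \<subseteq> S" "inj_on f T"
  obtains \<pi> where "\<pi> permutes S" "\<And>x. x \<in> T \<Longrightarrow> \<pi> x = f x"
proof -
  have fin: "finite T" using assms(1,2) finite_subset by blast
  have "card (S - T) = card (S - f ` T)"
    using assms fin by (simp add: card_Diff_subset card_image)
  then obtain g where g: "bij_betw g (S - T) (S - f ` T)"
    using finite_same_card_bij[of "S - T" "S - f ` T"] assms(1) by auto
  define \<pi> where "\<pi> = (\<lambda>x. if x \<in> T then f x else if x \<in> S then g x else x)"
  have "bij_betw \<pi> T (f ` T)"
    using assms(4) by (auto simp: \<pi>_def bij_betw_def inj_on_def)
  moreover have "bij_betw \<pi> (S - T) (S - f ` T)"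
    using g by (subst bij_betw_cong[of _ _ g]) (auto simp: \<pi>_def)
  ultimately have "bij_betw \<pi> (T \<union> (S - T)) (f ` T \<union> (S - f ` T))"
    by (rule bij_betw_combine) auto
  moreover have "T \<union> (S - T) = S" "f ` T \<union> (S - f ` T) = S" using assms(2,3) by auto
  ultimately have "\<pi> permutes S" by (intro bij_imp_permutes) (use assms(2) in \<open>auto simp: \<pi>_def\<close>)
  then show ?thesis using that by (simp add: \<pi>_def)
qed

lemma finite_perms: "finite (perms n)"
  by (simp add: perms_def finite_permutations)

text \<open>Conjugation by an extension of \<open>f\<close> to a permutation turns the event
  \<open>\<sigma> \<circ> f = f \<circ> \<tau>\<close> into the event that \<open>\<sigma>\<close> agrees with \<open>\<tau>\<close> on \<open>{1..p}\<close>.\<close>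

lemma sum_conjugation_invariant_equivariant:
  fixes P :: "(nat \<Rightarrow> nat) \<Rightarrow> real"
  assumes conj: "\<And>\<sigma> \<tau>. \<sigma> \<in> perms n \<Longrightarrow> \<tau> \<in> perms n \<Longrightarrow> P (\<sigma> \<circ> \<tau> \<circ> inv \<sigma>) = P \<tau>"
    and \<tau>: "\<tau> \<in> perms p" and p: "p \<le> n"
    and f: "f \<in> {1..p} \<rightarrow> {1..n}" "inj_on f {1..p}"
  shows "(\<Sum>\<sigma> | \<sigma> \<in> perms n \<and> (\<forall>t\<in>{1..p}. \<sigma> (f t) = f (\<tau> t)). P \<sigma>) =
    (\<Sum>\<sigma> | \<sigma> \<in> perms n \<and> (\<forall>t\<in>{1..p}. \<sigma> t = \<tau> t). P \<sigma>)"
proof -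
  have "{1..p} \<subseteq> {1..n}" "f ` {1..p} \<subseteq> {1..n}" using p f(1) by auto
  then obtain \<pi> where \<pi>: "\<pi> permutes {1..n}" and \<pi>f: "\<And>x. x \<in> {1..p} \<Longrightarrow> \<pi> x = f x"
    using inj_on_extends_to_permutation[of "{1..n}" "{1..p}" f] f(2) by auto
  have inv[simp]: "inv \<pi> (\<pi> x) = x" "\<pi> (inv \<pi> x) = x" for x
    using permutes_inverses[OF \<pi>] by auto
  have \<tau>_in: "\<tau> t \<in> {1..p}" if "t \<in> {1..p}" for t
    using \<tau> that permutes_in_image by (fastforce simp: perms_def)
  have inv\<pi>: "inv \<pi> permutes {1..n}" using permutes_inv[OF \<pi>] .
  show ?thesis
  proof (rule sum.reindex_bij_witness[where i = "\<lambda>\<sigma>. \<pi> \<circ> \<sigma> \<circ> inv \<pi>" and j = "\<lambda>\<sigma>. inv \<pi> \<circ> \<sigma> \<circ> \<pi>"])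
    fix \<sigma> assume "\<sigma> \<in> {\<sigma>. \<sigma> \<in> perms n \<and> (\<forall>t\<in>{1..p}. \<sigma> (f t) = f (\<tau> t))}"
    then have \<sigma>: "\<sigma> permutes {1..n}" and eq: "\<And>t. t \<in> {1..p} \<Longrightarrow> \<sigma> (f t) = f (\<tau> t)"
      by (auto simp: perms_def)
    show "\<pi> \<circ> (inv \<pi> \<circ> \<sigma> \<circ> \<pi>) \<circ> inv \<pi> = \<sigma>" by (simp add: fun_eq_iff)
    have mem: "inv \<pi> \<circ> \<sigma> \<circ> \<pi> \<in> perms n"
      unfolding perms_def using permutes_compose[OF \<pi> permutes_compose[OF \<sigma> inv\<pi>]]
      by (simp add: o_assoc)
    have "(inv \<pi> \<circ> \<sigma> \<circ> \<pi>) t = \<tau> t" if "t \<in> {1..p}" for t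
    proof -
      have "\<sigma> (\<pi> t) = \<pi> (\<tau> t)" using eq[OF that] \<pi>f[OF that] \<pi>f[OF \<tau>_in[OF that]] by simp
      then show ?thesis by simp
    qed
    then show "inv \<pi> \<circ> \<sigma> \<circ> \<pi> \<in> {\<sigma>. \<sigma> \<in> perms n \<and> (\<forall>t\<in>{1..p}. \<sigma> t = \<tau> t)}"
      using mem by blast
    have "P (\<pi> \<circ> (inv \<pi> \<circ> \<sigma> \<circ> \<pi>) \<circ> inv \<pi>) = P (inv \<pi> \<circ> \<sigma> \<circ> \<pi>)"
      using conj[OF _ mem] \<pi> by (simp add: perms_def)
    moreover have "\<pi> \<circ> (inv \<pi> \<circ> \<sigma> \<circ> \<pi>) \<circ> inv \<pi> = \<sigma>" by (simp add: fun_eq_iff)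
    ultimately show "P (inv \<pi> \<circ> \<sigma> \<circ> \<pi>) = P \<sigma>" by metis
  next
    fix \<sigma> assume "\<sigma> \<in> {\<sigma>. \<sigma> \<in> perms n \<and> (\<forall>t\<in>{1..p}. \<sigma> t = \<tau> t)}"
    then have \<sigma>: "\<sigma> permutes {1..n}" and eq: "\<And>t. t \<in> {1..p} \<Longrightarrow> \<sigma> t = \<tau> t"
      by (auto simp: perms_def)
    show "inv \<pi> \<circ> (\<pi> \<circ> \<sigma> \<circ> inv \<pi>) \<circ> \<pi> = \<sigma>" by (simp add: fun_eq_iff)
    have "\<pi> \<circ> \<sigma> \<circ> inv \<pi> \<in> perms n"
      unfolding perms_def using permutes_compose[OF inv\<pi> permutes_compose[OF \<sigma> \<pi>]]
      by (simp add: o_assoc)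
    moreover have "(\<pi> \<circ> \<sigma> \<circ> inv \<pi>) (f t) = f (\<tau> t)" if "t \<in> {1..p}" for t
    proof -
      have "inv \<pi> (f t) = t" using \<pi>f[OF that] inv(1)[of t] by simp
      then show ?thesis using eq[OF that] \<pi>f[OF \<tau>_in[OF that]] by simp
    qed
    ultimately show "\<pi> \<circ> \<sigma> \<circ> inv \<pi> \<in> {\<sigma>. \<sigma> \<in> perms n \<and> (\<forall>t\<in>{1..p}. \<sigma> (f t) = f (\<tau> t))}"
      by blast
  qed
qed

text \<open>Double counting: the cardinality becomes a sum of indicators over all injections, and
  after the sums are swapped each injection contributes the same weight. The falling factorial is
  the number of injections.\<close>

lemma sum_card_equivariant_injections:
  fixes P :: "(nat \<Rightarrow> nat) \<Rightarrow> real"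
  assumes conj: "\<And>\<sigma> \<tau>. \<sigma> \<in> perms n \<Longrightarrow> \<tau> \<in> perms n \<Longrightarrow> P (\<sigma> \<circ> \<tau> \<circ> inv \<sigma>) = P \<tau>"
    and \<tau>: "\<tau> \<in> perms p" and p: "p \<le> n"
  shows "(\<Sum>\<sigma>\<in>perms n. P \<sigma> * card (equivariant_injections {1..p} \<tau> {1..n} \<sigma>)) =
    (\<Prod>i<p. real (n - i)) * (\<Sum>\<sigma> | \<sigma> \<in> perms n \<and> (\<forall>t\<in>{1..p}. \<sigma> t = \<tau> t). P \<sigma>)"
    (is "?L = _ * ?S")
proof -
  let ?I = "{f \<in> {1..p} \<rightarrow>\<^sub>E {1..n}. inj_on f {1..p}}"
  let ?Q = "\<lambda>f \<sigma>. \<forall>t\<in>{1..p}. \<sigma> (f t) = f (\<tau> t)"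
  have fin: "finite ?I" by (rule finite_subset[of _ "{1..p} \<rightarrow>\<^sub>E {1..n}"]) (auto intro: finite_PiE)
  have "real (card (equivariant_injections {1..p} \<tau> {1..n} \<sigma>)) = (\<Sum>f\<in>?I. of_bool (?Q f \<sigma>))"
    for \<sigma>
  proof -
    have "equivariant_injections {1..p} \<tau> {1..n} \<sigma> = ?I \<inter> {f. ?Q f \<sigma>}"
      by (auto simp: equivariant_injections_def)
    then show ?thesis using fin by (simp add: sum_of_bool_eq)
  qed
  then have "?L = (\<Sum>\<sigma>\<in>perms n. \<Sum>f\<in>?I. P \<sigma> * of_bool (?Q f \<sigma>))"
    by (simp only: sum_distrib_left)
  also have "\<dots> = (\<Sum>f\<in>?I. \<Sum>\<sigma>\<in>perms n. P \<sigma> * of_bool (?Q f \<sigma>))"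
    by (rule sum.swap)
  also have "\<dots> = (\<Sum>f\<in>?I. ?S)"
  proof (rule sum.cong[OF refl])
    fix f assume "f \<in> ?I"
    then have f: "f \<in> {1..p} \<rightarrow> {1..n}" "inj_on f {1..p}" by auto
    have "(\<Sum>\<sigma>\<in>perms n. P \<sigma> * of_bool (?Q f \<sigma>)) = (\<Sum>\<sigma> | \<sigma> \<in> perms n \<and> ?Q f \<sigma>. P \<sigma>)"
      using finite_perms by (intro sum.mono_neutral_cong_right) auto
    also have "\<dots> = ?S" using sum_conjugation_invariant_equivariant[OF conj \<tau> p f] .
    finally show "(\<Sum>\<sigma>\<in>perms n. P \<sigma> * of_bool (?Q f \<sigma>)) = ?S" .
  qed
  also have "\<dots> = real (card ?I) * ?S" by simp
  also have "card ?I = (\<Prod>i<p. n - i)"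
    using card_inj_on_subset_funcset[of "{1..p}" "{1..n}" "{1..p}"]
    by (simp add: atLeast0LessThan)
  finally show ?thesis by simp
qed

section \<open>Limits of the binomial moments\<close>

lemma falling_factorial_over_power_tendsto:
  "(\<lambda>n. (\<Prod>i<p. real (n - i)) / real n ^ p) \<longlonglongrightarrow> 1"
proof -
  have "(\<lambda>n. \<Prod>i<p. real (n - i) / real n) \<longlonglongrightarrow> (\<Prod>i<p. 1)"
  proof (rule tendsto_prod)
    fix i
    have "(\<lambda>n. 1 - real i / real n) \<longlonglongrightarrow> 1 - 0"
      by (intro tendsto_intros lim_const_over_n)
    \<comment> \<open>From \<open>i + 1\<close> on, the natural subtraction is exact and the
      denominator is nonzero.\<close>
    moreover have "\<forall>\<^sub>F n in sequentially. 1 - real i / real n = real (n - i) / real n"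
      using eventually_ge_at_top[of "i + 1"]
      by eventually_elim (auto simp: field_simps of_nat_diff)
    ultimately show "(\<lambda>n. real (n - i) / real n) \<longlonglongrightarrow> 1"
      by (simp add: tendsto_cong)
  qed
  then show ?thesis by (simp add: prod_dividef)
qed

text \<open>The expected number of equivariant injections is computed twice: as a falling factorial
  times the agreement probability, which tends to 1, and as a constant times the binomial
  moment.\<close>

lemma binomial_moments_num_cycles_tendsto:
  fixes P :: "nat \<Rightarrow> (nat \<Rightarrow> nat) \<Rightarrow> real" and K :: "nat set"
  assumes K: "finite K" "\<forall>l\<in>K. l \<ge> 1"
    and F: "F \<le> sequentially"
    and conj: "\<forall>\<^sub>F n in F. \<forall>\<sigma>\<in>perms n. \<forall>\<tau>\<in>perms n. P n (\<sigma> \<circ> \<tau> \<circ> inv \<sigma>) = P n \<tau>"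
    and total: "\<forall>\<^sub>F n in F. (\<Sum>\<sigma>\<in>perms n. P n \<sigma>) = 1"
    and asymp: "\<And>p \<tau>. p \<ge> 1 \<Longrightarrow> \<tau> \<in> perms_cycles_in p K \<Longrightarrow>
      (\<lambda>n. \<Sum>\<sigma> | \<sigma> \<in> perms n \<and> (\<forall>t\<in>{1..p}. \<sigma> t = \<tau> t). P n \<sigma>) \<sim>[F] (\<lambda>n. 1 / real n ^ p)"
  shows "((\<lambda>n. \<Sum>\<sigma>\<in>perms n. P n \<sigma> * (\<Prod>l\<in>K. real (num_cycles n l \<sigma> choose m l)))
    \<longlongrightarrow> (\<Prod>l\<in>K. (1 / real l) ^ m l / fact (m l))) F"
proof -
  define p where "p = (\<Sum>l\<in>K. l * m l)"
  \<comment> \<open>The order of the centralizer of a permutation of \<open>p\<close> points with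
    \<open>m l\<close> cycles of length \<open>l\<close>: each cycle can be rotated, and cycles of
    equal length can be interchanged.\<close>
  define C where "C = (\<Prod>l\<in>K. real l ^ m l * fact (m l))"
  have C: "C \<noteq> 0" unfolding C_def using K by (auto simp: not_less_eq_eq)
  obtain \<tau> where \<tau>: "\<tau> \<in> perms_cycles_in p K"
    and cnt: "\<And>n \<sigma>. \<sigma> \<in> perms n \<Longrightarrow> card (equivariant_injections {1..p} \<tau> {1..n} \<sigma>) =
      (\<Prod>l\<in>K. l ^ m l * fact (m l) * (num_cycles n l \<sigma> choose m l))"
    using exists_perm_with_cycle_counts[OF K, of m] unfolding p_def by blast
  have \<tau>p: "\<tau> \<in> perms p" using \<tau> by (simp add: perms_cycles_in_def)
  define S where "S n = (\<Sum>\<sigma> | \<sigma> \<in> perms n \<and> (\<forall>t\<in>{1..p}. \<sigma> t = \<tau> t). P n \<sigma>)" for n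
  have large: "\<forall>\<^sub>F n in F. n \<ge> k" for k using F by (meson eventually_ge_at_top filter_leD)
  have "((\<lambda>n. S n / (1 / real n ^ p)) \<longlongrightarrow> 1) F"
  proof (cases "p = 0")
    \<comment> \<open>The asymptotic hypothesis starts at \<open>p = 1\<close>; for
      \<open>p = 0\<close> the constraint is empty and \<open>S n\<close> is the total mass.\<close>
    case True
    have "\<forall>\<^sub>F n in F. 1 = S n / (1 / real n ^ p)"
      using total by eventually_elim (simp add: S_def True)
    then show ?thesis by (rule Lim_transform_eventually[OF tendsto_const])
  next
    \<comment> \<open>\<open>asymp_equiv\<close> sets the ratio to 1 wherever both sides vanish. For
      \<open>n \<ge> 1\<close> the comparison function is nonzero, so the plain quotient
      converges.\<close>
    case False
    have "\<forall>\<^sub>F n in F. S n \<noteq> 0 \<or> 1 / real n ^ p \<noteq> 0"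
      using large[of 1] by eventually_elim simp
    moreover have "S \<sim>[F] (\<lambda>n. 1 / real n ^ p)"
      unfolding S_def using asymp[OF _ \<tau>] False by simp
    ultimately show ?thesis by (rule asymp_equivD_strong[rotated])
  qed
  moreover have "((\<lambda>n. (\<Prod>i<p. real (n - i)) / real n ^ p) \<longlongrightarrow> 1) F"
    using falling_factorial_over_power_tendsto F by (rule tendsto_mono[rotated])
  ultimately have "((\<lambda>n. (\<Prod>i<p. real (n - i)) / real n ^ p * (S n / (1 / real n ^ p)) / C)
      \<longlongrightarrow> 1 * 1 / C) F"
    using C by (intro tendsto_intros)
  moreover have "\<forall>\<^sub>F n in F.
      (\<Prod>i<p. real (n - i)) / real n ^ p * (S n / (1 / real n ^ p)) / C =
      (\<Sum>\<sigma>\<in>perms n. P n \<sigma> * (\<Prod>l\<in>K. real (num_cycles n l \<sigma> choose m l)))"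
    \<comment> \<open>\<open>n \<ge> p\<close> places \<open>{1..p}\<close> inside
      \<open>{1..n}\<close>, and \<open>n \<ge> 1\<close> lets the powers of \<open>n\<close>
      cancel.\<close>
    using conj large[of p] large[of 1]
  proof eventually_elim
    case (elim n)
    have "(\<Prod>i<p. real (n - i)) * S n =
        (\<Sum>\<sigma>\<in>perms n. P n \<sigma> * card (equivariant_injections {1..p} \<tau> {1..n} \<sigma>))"
      unfolding S_def using elim \<tau>p by (intro sum_card_equivariant_injections[symmetric]) auto
    also have "\<dots> = (\<Sum>\<sigma>\<in>perms n. P n \<sigma> * (\<Prod>l\<in>K. real (num_cycles n l \<sigma> choose m l))) * C"
      unfolding sum_distrib_right C_def
      by (intro sum.cong refl, subst cnt) (simp_all add: prod.distrib)
    finally show ?case using C elim(3) by simp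
  qed
  ultimately have "((\<lambda>n. \<Sum>\<sigma>\<in>perms n. P n \<sigma> * (\<Prod>l\<in>K. real (num_cycles n l \<sigma> choose m l)))
      \<longlongrightarrow> 1 * 1 / C) F"
    by (rule Lim_transform_eventually)
  moreover have "1 * 1 / C = (\<Prod>l\<in>K. (1 / real l) ^ m l / fact (m l))"
    by (simp add: C_def prod_dividef prod.distrib power_divide)
  ultimately show ?thesis by simp
qed

section \<open>From binomial moments to weak convergence\<close>

text \<open>Pascal's rule makes the sum telescope. Writing the upper index as \<open>Suc n\<close>
  sets aside row 0, where the sum is 1 for every \<open>I\<close>.\<close>

lemma alternating_binomial_partial_sum:
  "(\<Sum>i\<le>I. (-1) ^ i * real (Suc n choose i)) = (-1) ^ I * real (n choose I)"
proof (induction I)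
  case (Suc I)
  then show ?case by (simp add: algebra_simps)
qed simp

text \<open>For \<open>k \<le> N\<close> the factor \<open>N choose k\<close> can be pulled out,
  leaving an alternating partial sum of row \<open>N - k\<close>. It differs from the indicator of
  \<open>N = k\<close> by at most the first omitted binomial coefficient. For \<open>N < k\<close>
  every term vanishes.\<close>

lemma bonferroni:
  "\<bar>of_bool (N = k) - (\<Sum>i\<le>I. (-1) ^ i * real (k + i choose k) * real (N choose (k + i)))\<bar>
    \<le> real (k + Suc I choose k) * real (N choose (k + Suc I))"
proof -
  have mult: "real (k + i choose k) * real (N choose (k + i)) =
      real (N choose k) * real (N - k choose i)" if "k \<le> N" for i
  proof (cases "k + i \<le> N")
    case True
    then show ?thesis
      using choose_mult[of k "k + i" N] by (simp add: algebra_simps flip: of_nat_mult)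
  next
    case False
    then have "N < k + i" "N - k < i" using that by auto
    then show ?thesis by (simp add: binomial_eq_0)
  qed
  show ?thesis
  proof (cases "k \<le> N")
    case True
    have "(\<Sum>i\<le>I. (-1) ^ i * real (k + i choose k) * real (N choose (k + i))) =
        real (N choose k) * (\<Sum>i\<le>I. (-1) ^ i * real (N - k choose i))"
      unfolding sum_distrib_left
      by (intro sum.cong refl) (metis mult[OF True] mult.assoc mult.left_commute)
    moreover have "\<bar>of_bool (N = k) - real (N choose k) * (\<Sum>i\<le>I. (-1) ^ i * real (N - k choose i))\<bar>
        \<le> real (N choose k) * real (N - k choose Suc I)"
    proof (cases "N = k")
      case True
      have "(\<Sum>i\<le>I. (-1) ^ i * real (0 choose i)) = (\<Sum>i\<in>{0}. (-1) ^ i * real (0 choose i))"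
        by (rule sum.mono_neutral_right) auto
      then show ?thesis using True by simp
    next
      case False
      then obtain n where n: "N - k = Suc n" using True by (metis Suc_diff_Suc le_neq_implies_less)
      \<comment> \<open>The partial sum has absolute value \<open>n choose I\<close>, which Pascal's
        rule bounds by \<open>Suc n choose Suc I\<close>.\<close>
      show ?thesis
        unfolding n alternating_binomial_partial_sum using False
        by (simp add: abs_mult mult_left_mono)
    qed
    ultimately show ?thesis using mult[OF True, of "Suc I"] by simp
  next
    case False
    then show ?thesis by (simp add: binomial_eq_0)
  qed
qed

text \<open>The truncation level \<open>I\<close> is fixed before the limit along \<open>F\<close>
  is taken, so nothing has to be uniform in \<open>I\<close>. Four errors below \<open>e/4\<close>
  add up: \<open>b\<close> against \<open>\<beta>\<close>, \<open>\<beta>\<close> against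
  \<open>c\<close>, \<open>r\<close> against \<open>\<rho>\<close>, and \<open>\<rho>\<close>
  against 0.\<close>

lemma tendsto_by_approximation:
  fixes a :: "'i \<Rightarrow> real" and b r :: "nat \<Rightarrow> 'i \<Rightarrow> real"
  assumes ab: "\<And>I. \<forall>\<^sub>F n in F. \<bar>a n - b I n\<bar> \<le> r I n"
    and b: "\<And>I. (b I \<longlongrightarrow> \<beta> I) F" and r: "\<And>I. (r I \<longlongrightarrow> \<rho> I) F"
    and \<beta>: "\<beta> \<longlonglongrightarrow> c" and \<rho>: "\<rho> \<longlonglongrightarrow> 0"
  shows "(a \<longlongrightarrow> c) F"
proof (rule tendstoI)
  fix e :: real assume e: "e > 0"
  have "\<forall>\<^sub>F I in sequentially. dist (\<beta> I) c < e/4 \<and> dist (\<rho> I) 0 < e/4"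
    using \<beta> \<rho> e by (intro eventually_conj tendstoD) auto
  then obtain I where I: "dist (\<beta> I) c < e/4" "dist (\<rho> I) 0 < e/4"
    by (auto simp: eventually_sequentially)
  have "\<forall>\<^sub>F n in F. dist (b I n) (\<beta> I) < e/4" "\<forall>\<^sub>F n in F. dist (r I n) (\<rho> I) < e/4"
    using tendstoD[OF b, of "e/4" I] tendstoD[OF r, of "e/4" I] e by simp_all
  then show "\<forall>\<^sub>F n in F. dist (a n) c < e"
    using ab[of I]
  proof eventually_elim
    case (elim n)
    then show ?case using I unfolding dist_real_def by linarith
  qed
qed

text \<open>The truncated alternating sums of \<open>bonferroni\<close> replace one binomial moment at a time by a
  point mass.\<close>

lemma point_masses_tendsto_of_binomial_moments:
  fixes w :: "'i \<Rightarrow> 's \<Rightarrow> real" and N :: "'i \<Rightarrow> 'k \<Rightarrow> 's \<Rightarrow> nat" and S :: "'i \<Rightarrow> 's set"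
  assumes K: "finite K"
    and w: "\<forall>\<^sub>F n in F. \<forall>s\<in>S n. w n s \<ge> 0"
    and moments: "\<And>m. ((\<lambda>n. \<Sum>s\<in>S n. w n s * (\<Prod>l\<in>K. real (N n l s choose m l)))
      \<longlongrightarrow> (\<Prod>l\<in>K. rate l ^ m l / fact (m l))) F"
  shows "((\<lambda>n. \<Sum>s\<in>S n. w n s * (\<Prod>l\<in>K. of_bool (N n l s = m l)))
    \<longlongrightarrow> (\<Prod>l\<in>K. exp (- rate l) * (rate l ^ m l / fact (m l)))) F"
proof -
  have "((\<lambda>n. \<Sum>s\<in>S n. w n s * ((\<Prod>l\<in>L. of_bool (N n l s = m l)) *
        (\<Prod>l\<in>K - L. real (N n l s choose m l))))
      \<longlongrightarrow> (\<Prod>l\<in>L. exp (- rate l) * (rate l ^ m l / fact (m l))) *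
        (\<Prod>l\<in>K - L. rate l ^ m l / fact (m l))) F"
    if "L \<subseteq> K" for L
  proof -
    have "finite L" using that K finite_subset by blast
    then show ?thesis using that
    \<comment> \<open>\<open>m\<close> is generalized because replacing coordinate \<open>l\<close>
      uses the induction hypothesis for all values of \<open>m l\<close>.\<close>
    proof (induction L arbitrary: m rule: finite_induct)
      case empty
      then show ?case using moments by simp
    next
      case (insert l L)
      have l: "l \<in> K - L" and L: "L \<subseteq> K" and KL: "finite (K - L)" using insert K by auto
      have rest: "K - insert l L = K - L - {l}" by auto
      \<comment> \<open>\<open>g\<close> gathers the weight and all factors apart from coordinate
        \<open>l\<close>; \<open>G\<close> gathers the matching factors of the limit.\<close>
      define g :: "'i \<Rightarrow> 's \<Rightarrow> real" where "g n s = w n s * ((\<Prod>j\<in>L. of_bool (N n j s = m j)) *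
        (\<Prod>j\<in>K - L - {l}. real (N n j s choose m j)))" for n s
      define G where "G = (\<Prod>j\<in>L. exp (- rate j) * (rate j ^ m j / fact (m j))) *
        (\<Prod>j\<in>K - L - {l}. rate j ^ m j / fact (m j))"
      have eqL: "(\<Prod>j\<in>L. h j ((m(l := q)) j)) = (\<Prod>j\<in>L. h j (m j))"
        for h :: "'k \<Rightarrow> nat \<Rightarrow> real" and q
        using l by (intro prod.cong) auto
      have eqR: "(\<Prod>j\<in>K - L. h j ((m(l := q)) j)) = h l q * (\<Prod>j\<in>K - L - {l}. h j (m j))"
        for h :: "'k \<Rightarrow> nat \<Rightarrow> real" and q
        using prod.remove[OF KL l, of "\<lambda>j. h j ((m(l := q)) j)"] by simp
      have lim: "((\<lambda>n. \<Sum>s\<in>S n. g n s * real (N n l s choose q)) \<longlongrightarrow> G * (rate l ^ q / fact q)) F"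
        for q
        using insert.IH[OF L, of "m(l := q)"]
        unfolding eqL[of "\<lambda>j k. of_bool (N _ j _ = k)"] eqL[of "\<lambda>j k. exp (- rate j) * (rate j ^ k / fact k)"]
          eqR[of "\<lambda>j k. real (N _ j _ choose k)"] eqR[of "\<lambda>j k. rate j ^ k / fact k"]
        by (simp add: g_def G_def mult_ac)
      let ?k = "m l"
      let ?c = "\<lambda>i. (-1) ^ i * real (?k + i choose ?k)"
      let ?d = "\<lambda>I. real (?k + Suc I choose ?k)"
      \<comment> \<open>The Bonferroni coefficient splits the limiting moment of order
        \<open>?k + i\<close> into the factor of order \<open>?k\<close> and a term of the
        exponential series. With alternating signs these terms sum to
        \<open>exp (- rate l)\<close>.\<close>
      have term_eq: "real (?k + i choose ?k) * (rate l ^ (?k + i) / fact (?k + i)) =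
          rate l ^ ?k / fact ?k * (rate l ^ i / fact i)" for i
        by (simp add: binomial_fact power_add)
      have exp_sums: "(\<lambda>i. (- rate l) ^ i / fact i) sums exp (- rate l)"
        using exp_converges[of "- rate l"] by (simp add: field_simps)
      have "((\<lambda>n. \<Sum>s\<in>S n. g n s * of_bool (N n l s = ?k)) \<longlongrightarrow>
          G * (rate l ^ ?k / fact ?k) * exp (- rate l)) F"
      proof (rule tendsto_by_approximation)
        fix I
        show "\<forall>\<^sub>F n in F.
            \<bar>(\<Sum>s\<in>S n. g n s * of_bool (N n l s = ?k)) -
              (\<Sum>i\<le>I. ?c i * (\<Sum>s\<in>S n. g n s * real (N n l s choose (?k + i))))\<bar>
            \<le> ?d I * (\<Sum>s\<in>S n. g n s * real (N n l s choose (?k + Suc I)))"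
          using w
        proof eventually_elim
          case (elim n)
          \<comment> \<open>Nonnegative weights allow the pointwise Bonferroni bound to be summed
            over \<open>S n\<close>.\<close>
          have g0: "g n s \<ge> 0" if "s \<in> S n" for s
            unfolding g_def using elim that by (intro mult_nonneg_nonneg prod_nonneg) auto
          have "(\<Sum>i\<le>I. ?c i * (\<Sum>s\<in>S n. g n s * real (N n l s choose (?k + i)))) =
              (\<Sum>s\<in>S n. g n s * (\<Sum>i\<le>I. ?c i * real (N n l s choose (?k + i))))"
            unfolding sum_distrib_left by (subst sum.swap) (simp add: mult_ac)
          then have "(\<Sum>s\<in>S n. g n s * of_bool (N n l s = ?k)) -
              (\<Sum>i\<le>I. ?c i * (\<Sum>s\<in>S n. g n s * real (N n l s choose (?k + i)))) =
              (\<Sum>s\<in>S n. g n s * (of_bool (N n l s = ?k) -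
                (\<Sum>i\<le>I. ?c i * real (N n l s choose (?k + i)))))"
            by (simp add: sum_subtractf right_diff_distrib)
          also have "\<bar>\<dots>\<bar> \<le> (\<Sum>s\<in>S n. g n s * (?d I * real (N n l s choose (?k + Suc I))))"
          proof (rule order_trans[OF sum_abs sum_mono])
            fix s assume "s \<in> S n"
            then show "\<bar>g n s * (of_bool (N n l s = ?k) -
                (\<Sum>i\<le>I. ?c i * real (N n l s choose (?k + i))))\<bar>
                \<le> g n s * (?d I * real (N n l s choose (?k + Suc I)))"
              unfolding abs_mult using g0[of s] bonferroni[of "N n l s" ?k I]
              by (simp only: abs_of_nonneg mult_left_mono)
          qed
          also have "\<dots> = ?d I * (\<Sum>s\<in>S n. g n s * real (N n l s choose (?k + Suc I)))"
            by (simp add: sum_distrib_left mult_ac)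
          finally show ?case .
        qed
      next
        fix I
        show "((\<lambda>n. \<Sum>i\<le>I. ?c i * (\<Sum>s\<in>S n. g n s * real (N n l s choose (?k + i)))) \<longlongrightarrow>
            (\<Sum>i\<le>I. ?c i * (G * (rate l ^ (?k + i) / fact (?k + i))))) F"
          by (intro tendsto_sum tendsto_mult tendsto_const lim)
        show "((\<lambda>n. ?d I * (\<Sum>s\<in>S n. g n s * real (N n l s choose (?k + Suc I)))) \<longlongrightarrow>
            ?d I * (G * (rate l ^ (?k + Suc I) / fact (?k + Suc I)))) F"
          by (intro tendsto_mult tendsto_const lim)
      next
        have "?c i * (G * (rate l ^ (?k + i) / fact (?k + i))) =
            G * (rate l ^ ?k / fact ?k) * ((- rate l) ^ i / fact i)" for i
        proof -
          have "?c i * (G * (rate l ^ (?k + i) / fact (?k + i))) =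
              (-1) ^ i * G * (real (?k + i choose ?k) * (rate l ^ (?k + i) / fact (?k + i)))"
            by (simp only: mult_ac)
          then show ?thesis
            unfolding term_eq power_minus[of "rate l"] by simp
        qed
        then have "(\<lambda>i. ?c i * (G * (rate l ^ (?k + i) / fact (?k + i)))) sums
            (G * (rate l ^ ?k / fact ?k) * exp (- rate l))"
          using sums_mult[OF exp_sums, of "G * (rate l ^ ?k / fact ?k)"] by (simp only:)
        then show "(\<lambda>I. \<Sum>i\<le>I. ?c i * (G * (rate l ^ (?k + i) / fact (?k + i)))) \<longlonglongrightarrow>
            G * (rate l ^ ?k / fact ?k) * exp (- rate l)"
          by (simp add: sums_def_le)
      next
        \<comment> \<open>The limiting remainder is a constant times a term of the convergent
          exponential series, so it vanishes as \<open>I\<close> grows.\<close>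
        have "?d I * (G * (rate l ^ (?k + Suc I) / fact (?k + Suc I))) =
            G * (rate l ^ ?k / fact ?k) * (rate l ^ Suc I / fact (Suc I))" for I
        proof -
          have "?d I * (G * (rate l ^ (?k + Suc I) / fact (?k + Suc I))) =
              G * (?d I * (rate l ^ (?k + Suc I) / fact (?k + Suc I)))"
            by (simp only: mult_ac)
          then show ?thesis unfolding term_eq by (simp only: mult.assoc)
        qed
        moreover have "(\<lambda>I. rate l ^ Suc I / fact (Suc I)) \<longlonglongrightarrow> 0"
          using LIMSEQ_Suc[OF summable_LIMSEQ_zero[OF summable_exp[of "rate l"]]]
          by (simp only: divide_inverse mult.commute)
        ultimately show "(\<lambda>I. ?d I * (G * (rate l ^ (?k + Suc I) / fact (?k + Suc I)))) \<longlonglongrightarrow> 0"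
          by (simp only: tendsto_mult_right_zero)
      qed
      then show ?case
        unfolding rest using insert(1,2)
        by (simp add: g_def G_def mult_ac)
    qed
  qed
  from this[of K] show ?thesis by simp
qed

section \<open>Convergence of integrals on a countable space\<close>

text \<open>Finite sets carry almost all of the mass of \<open>\<nu>\<close>. As the total mass is
  1, convergence of the point masses on such a set also controls the mass of \<open>\<mu> n\<close>
  outside it, so no mass escapes.\<close>

lemma tendsto_integral_discrete:
  fixes f :: "'b \<Rightarrow> real"
  assumes \<Omega>: "countable \<Omega>"
    and \<mu>: "\<forall>\<^sub>F n in F. prob_space (\<mu> n) \<and> sets (\<mu> n) = Pow \<Omega>"
    and \<nu>: "prob_space \<nu>" "sets \<nu> = Pow \<Omega>"
    and lim: "\<And>x. x \<in> \<Omega> \<Longrightarrow> ((\<lambda>n. measure (\<mu> n) {x}) \<longlongrightarrow> measure \<nu> {x}) F"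
    and f: "\<And>x. x \<in> \<Omega> \<Longrightarrow> \<bar>f x\<bar> \<le> B"
  shows "((\<lambda>n. \<integral>x. f x \<partial>\<mu> n) \<longlongrightarrow> (\<integral>x. f x \<partial>\<nu>)) F"
proof -
  \<comment> \<open>The law \<open>\<rho>\<close> is arbitrary because the bound serves both
    \<open>\<mu> n\<close> and \<open>\<nu>\<close>.\<close>
  have approx: "\<bar>(\<integral>x. f x \<partial>\<rho>) - (\<Sum>x\<in>T. f x * measure \<rho> {x})\<bar> \<le> B * (1 - (\<Sum>x\<in>T. measure \<rho> {x}))"
    if \<rho>: "prob_space \<rho>" "sets \<rho> = Pow \<Omega>" and T: "finite T" "T \<subseteq> \<Omega>" for \<rho> and T :: "'b set"
  proof -
    interpret prob_space \<rho> by fact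
    have sp: "space \<rho> = \<Omega>" using \<rho>(2) sets_eq_imp_space_eq[of \<rho> "count_space \<Omega>"] by simp
    have meas: "g \<in> borel_measurable \<rho>" for g :: "'b \<Rightarrow> real"
      using sp \<rho>(2) by (auto simp: measurable_def)
    have int_f: "integrable \<rho> f"
      by (rule integrable_const_bound[of _ B]) (use f sp meas in auto)
    have int_T: "integrable \<rho> (\<lambda>x. g x * indicator {y} x)" for g :: "'b \<Rightarrow> real" and y
      by (rule integrable_const_bound[of _ "\<bar>g y\<bar>"]) (use meas in \<open>auto simp: indicator_def\<close>)
    have single: "(\<integral>x. g x * indicator {y} x \<partial>\<rho>) = g y * measure \<rho> {y}"
      if "y \<in> T" for g :: "'b \<Rightarrow> real" and y
    proof -
      have "(\<lambda>x. g x * indicator {y} x) = (\<lambda>x. g y * indicator {y} x)"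
        by (auto simp: indicator_def)
      moreover have "{y} \<inter> space \<rho> = {y}" using that T(2) sp by auto
      ultimately show ?thesis by (simp add: Int_commute)
    qed
    have sum_T: "(\<Sum>y\<in>T. g y * measure \<rho> {y}) = (\<integral>x. (\<Sum>y\<in>T. g x * indicator {y} x) \<partial>\<rho>)"
      for g :: "'b \<Rightarrow> real"
      using int_T single by (subst Bochner_Integration.integral_sum) auto
    have ind: "(\<Sum>y\<in>T. g x * indicator {y} x) = g x * indicator T x" for g :: "'b \<Rightarrow> real" and x
      using T(1) by (simp add: sum_distrib_left[symmetric] indicator_def)
    have "integrable \<rho> (\<lambda>x. g x * indicator T x)" for g :: "'b \<Rightarrow> real"
      unfolding ind[symmetric] using int_T by (intro Bochner_Integration.integrable_sum)
    from this[of f] this[of "\<lambda>_. 1"]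
    have int_ind: "integrable \<rho> (\<lambda>x. f x * indicator T x)" "integrable \<rho> (\<lambda>x. indicator T x :: real)"
      by simp_all
    have "(\<integral>x. f x \<partial>\<rho>) - (\<Sum>x\<in>T. f x * measure \<rho> {x}) = (\<integral>x. f x - f x * indicator T x \<partial>\<rho>)"
      unfolding sum_T ind using int_f int_ind by simp
    also have "\<bar>\<dots>\<bar> \<le> (\<integral>x. B * (1 - indicator T x) \<partial>\<rho>)"
    proof (rule order_trans[OF integral_abs_bound integral_mono])
      show "\<bar>f x - f x * indicator T x\<bar> \<le> B * (1 - indicator T x)" if "x \<in> space \<rho>" for x
        using f[of x] that sp by (auto simp: indicator_def)
    qed (use int_f int_ind in auto)
    also have "\<dots> = B * (1 - measure \<rho> T)"
      using int_ind T(2)[folded sp] by (simp add: prob_space Int_absorb2)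
    also have "measure \<rho> T = (\<Sum>x\<in>T. measure \<rho> {x})"
      using T \<rho>(2) by (intro finite_measure_eq_sum_singleton) auto
    finally show ?thesis .
  qed
  have exhaust: "\<exists>T. (\<forall>I. finite (T I) \<and> T I \<subseteq> \<Omega>) \<and> (\<lambda>I. \<Sum>x\<in>T I. measure \<nu> {x}) \<longlonglongrightarrow> 1"
  proof -
    interpret prob_space \<nu> by fact
    have sp: "space \<nu> = \<Omega>" using \<nu>(2) sets_eq_imp_space_eq[of \<nu> "count_space \<Omega>"] by simp
    then have ne: "\<Omega> \<noteq> {}" using not_empty by simp
    \<comment> \<open>Initial segments of an enumeration; \<open>from_nat_into\<close> returns an
      element of \<open>\<Omega>\<close> at every index, so finite \<open>\<Omega>\<close> is
      covered too.\<close>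
    define T where "T I = from_nat_into \<Omega> ` {..I}" for I
    have T: "finite (T I)" "T I \<subseteq> \<Omega>" for I
      using from_nat_into[OF ne] by (auto simp: T_def)
    have "(\<lambda>I. measure \<nu> (T I)) \<longlonglongrightarrow> measure \<nu> (\<Union>I. T I)"
      using T(2) \<nu>(2) by (intro finite_Lim_measure_incseq) (auto simp: incseq_def T_def)
    moreover have "(\<Union>I. T I) = space \<nu>"
      unfolding sp T_def using range_from_nat_into[OF ne \<Omega>]
      by (simp only: image_UN[symmetric] UN_atMost_UNIV)
    moreover have "measure \<nu> (T I) = (\<Sum>x\<in>T I. measure \<nu> {x})" for I
      using T[of I] \<nu>(2) by (intro finite_measure_eq_sum_singleton) auto
    ultimately show ?thesis using T by (intro exI[of _ T]) (simp add: prob_space)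
  qed
  then obtain T where T: "\<And>I. finite (T I)" "\<And>I. T I \<subseteq> \<Omega>"
    and T1: "(\<lambda>I. \<Sum>x\<in>T I. measure \<nu> {x}) \<longlonglongrightarrow> 1" by blast
  show ?thesis
  proof (rule tendsto_by_approximation)
    fix I
    show "\<forall>\<^sub>F n in F. \<bar>(\<integral>x. f x \<partial>\<mu> n) - (\<Sum>x\<in>T I. f x * measure (\<mu> n) {x})\<bar>
        \<le> B * (1 - (\<Sum>x\<in>T I. measure (\<mu> n) {x}))"
      using \<mu> by eventually_elim (use approx T in blast)
    show "((\<lambda>n. \<Sum>x\<in>T I. f x * measure (\<mu> n) {x}) \<longlongrightarrow> (\<Sum>x\<in>T I. f x * measure \<nu> {x})) F"
      using T(2)[of I] by (intro tendsto_intros lim) auto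
    show "((\<lambda>n. B * (1 - (\<Sum>x\<in>T I. measure (\<mu> n) {x}))) \<longlongrightarrow>
        B * (1 - (\<Sum>x\<in>T I. measure \<nu> {x}))) F"
      using T(2)[of I] by (intro tendsto_intros lim) auto
  next
    have "(\<lambda>I. B * (1 - (\<Sum>x\<in>T I. measure \<nu> {x}))) \<longlonglongrightarrow> B * (1 - 1)"
      by (intro tendsto_intros T1)
    then show rho0: "(\<lambda>I. B * (1 - (\<Sum>x\<in>T I. measure \<nu> {x}))) \<longlonglongrightarrow> 0" by simp
    \<comment> \<open>The same estimate for \<open>\<nu>\<close> itself, whose right-hand side tends
      to 0, identifies the limit of the truncated sums.\<close>
    have "(\<lambda>I. (\<Sum>x\<in>T I. f x * measure \<nu> {x}) - (\<integral>x. f x \<partial>\<nu>)) \<longlonglongrightarrow> 0"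
      using approx[OF \<nu> T]
      by (intro Lim_null_comparison[OF _ rho0] always_eventually) (simp add: abs_minus_commute)
    then show "(\<lambda>I. \<Sum>x\<in>T I. f x * measure \<nu> {x}) \<longlonglongrightarrow> (\<integral>x. f x \<partial>\<nu>)"
      by (rule LIM_zero_cancel)
  qed
qed

text \<open>Extensionality makes the singleton a box with one-point sides, so its product measure
  factorizes.\<close>

lemma measure_PiM_measure_pmf_singleton:
  assumes "finite K" "x \<in> extensional K"
  shows "measure (\<Pi>\<^sub>M l\<in>K. measure_pmf (q l)) {x} = (\<Prod>l\<in>K. pmf (q l) (x l))"
proof -
  interpret product_prob_space "\<lambda>l. measure_pmf (q l)" K
    by (intro product_prob_spaceI) (rule prob_space_measure_pmf)
  interpret finite_product_prob_space "\<lambda>l. measure_pmf (q l)" K by standard fact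
  have "{x} = (\<Pi>\<^sub>E l\<in>K. {x l})"
    using assms(2) by (auto simp: PiE_singleton)
  then show ?thesis using finite_measure_PiM_emb[of "\<lambda>l. {x l}"] by (simp add: pmf.rep_eq)
qed

lemma prod_of_bool: "finite K \<Longrightarrow> (\<Prod>l\<in>K. of_bool (Q l)) = (of_bool (\<forall>l\<in>K. Q l) :: 'a :: comm_semiring_1)"
  by (induction K rule: finite_induct) auto

section \<open>Poisson limit of the cycle counts\<close>

theorem corollary1p3:
  fixes \<N> A K :: "nat set"
    and M :: "nat \<Rightarrow> 'a measure"
    and X :: "nat \<Rightarrow> 'a \<Rightarrow> (nat \<Rightarrow> nat)"
  assumes "infinite \<N>" and "\<forall>n\<in>\<N>. n \<ge> 1"
    and "\<forall>a\<in>A. a \<ge> 1"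
    and "\<forall>n\<in>\<N>. prob_space (M n)"
    and "\<forall>n\<in>\<N>. X n \<in> M n \<rightarrow>\<^sub>M count_space (perms n)"
    and "\<forall>n\<in>\<N>. conjugation_invariant n (distr (M n) (count_space (perms n)) (X n))"
    and "\<forall>p\<ge>1. \<forall>\<sigma> \<in> perms_cycles_in p A.
      (\<lambda>n. measure (M n) {\<omega> \<in> space (M n). \<forall>m\<in>{1..p}. X n \<omega> m = \<sigma> m})
        \<sim>[inf sequentially (principal \<N>)] (\<lambda>n. 1 / real n ^ p)"
    and "finite K" and "K \<subseteq> A"
  shows "weakly_converges (nat_vectors_topology K)
    (\<lambda>n. distr (M n) (nat_vectors K) (\<lambda>\<omega>. \<lambda>l\<in>K. num_cycles n l (X n \<omega>)))
    (\<Pi>\<^sub>M l\<in>K. measure_pmf (poisson_pmf (1 / real l)))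
    (inf sequentially (principal \<N>))"
proof -
  let ?F = "inf sequentially (principal \<N>)"
  let ?\<mu> = "\<lambda>n. distr (M n) (nat_vectors K) (\<lambda>\<omega>. \<lambda>l\<in>K. num_cycles n l (X n \<omega>))"
  let ?\<nu> = "\<Pi>\<^sub>M l\<in>K. measure_pmf (poisson_pmf (1 / real l))"
  let ?\<Omega> = "\<Pi>\<^sub>E l\<in>K. (UNIV :: nat set)"
  \<comment> \<open>The point masses of the law of \<open>X n\<close> are the weights of the
    combinatorial lemmas. As \<open>perms n\<close> is finite, the probability of any event about
    \<open>X n\<close> is a finite sum of them.\<close>
  define P where "P n \<sigma> = measure (distr (M n) (count_space (perms n)) (X n)) {\<sigma>}" for n \<sigma>
  have in_\<N>: "\<forall>\<^sub>F n in ?F. n \<in> \<N>" by (simp add: eventually_inf_principal)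
  have K1: "\<forall>l\<in>K. l \<ge> 1" using assms(3,9) by blast
  have vec: "nat_vectors K = count_space ?\<Omega>"
    using \<open>finite K\<close> by (rule count_space_PiM_finite) simp
  have law: "measure (M n) {\<omega> \<in> space (M n). Q (X n \<omega>)} = (\<Sum>\<sigma> | \<sigma> \<in> perms n \<and> Q \<sigma>. P n \<sigma>)"
    if n: "n \<in> \<N>" for n Q
  proof -
    have X: "X n \<in> M n \<rightarrow>\<^sub>M count_space (perms n)" using assms(5) n by blast
    interpret D: prob_space "distr (M n) (count_space (perms n)) (X n)"
      using assms(4) n X by (intro prob_space.prob_space_distr) auto
    have "{\<omega> \<in> space (M n). Q (X n \<omega>)} = X n -` {\<sigma> \<in> perms n. Q \<sigma>} \<inter> space (M n)"
      using measurable_space[OF X] by auto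
    then have "measure (M n) {\<omega> \<in> space (M n). Q (X n \<omega>)} =
        measure (distr (M n) (count_space (perms n)) (X n)) {\<sigma> \<in> perms n. Q \<sigma>}"
      using measure_distr[OF X, of "{\<sigma> \<in> perms n. Q \<sigma>}"] by auto
    also have "\<dots> = (\<Sum>\<sigma> | \<sigma> \<in> perms n \<and> Q \<sigma>. P n \<sigma>)"
      unfolding P_def using finite_perms[of n] by (intro D.finite_measure_eq_sum_singleton) auto
    finally show ?thesis .
  qed
  have moments: "((\<lambda>n. \<Sum>\<sigma>\<in>perms n. P n \<sigma> * (\<Prod>l\<in>K. real (num_cycles n l \<sigma> choose m l)))
      \<longlongrightarrow> (\<Prod>l\<in>K. (1 / real l) ^ m l / fact (m l))) ?F" for m
  proof (rule binomial_moments_num_cycles_tendsto[OF \<open>finite K\<close> K1 inf_le1])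
    show "\<forall>\<^sub>F n in ?F. \<forall>\<sigma>\<in>perms n. \<forall>\<tau>\<in>perms n. P n (\<sigma> \<circ> \<tau> \<circ> inv \<sigma>) = P n \<tau>"
      using in_\<N> by eventually_elim (use assms(6) in \<open>simp add: P_def conjugation_invariant_def\<close>)
    show "\<forall>\<^sub>F n in ?F. (\<Sum>\<sigma>\<in>perms n. P n \<sigma>) = 1"
      using in_\<N>
    proof eventually_elim
      case (elim n)
      then show ?case
        using law[of n "\<lambda>_. True"] assms(4) prob_space.prob_space[of "M n"] by simp
    qed
    fix p \<tau> assume p: "p \<ge> (1::nat)" and \<tau>: "\<tau> \<in> perms_cycles_in p K"
    \<comment> \<open>Cycle lengths in \<open>K\<close> are cycle lengths in \<open>A\<close>, so
      the asymptotic hypothesis applies to \<open>\<tau>\<close>.\<close>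
    have "\<tau> \<in> perms_cycles_in p A" using \<tau> assms(9) by (auto simp: perms_cycles_in_def)
    then have a: "(\<lambda>n. measure (M n) {\<omega> \<in> space (M n). \<forall>m\<in>{1..p}. X n \<omega> m = \<tau> m})
        \<sim>[?F] (\<lambda>n. 1 / real n ^ p)" using assms(7) p by blast
    have e: "\<forall>\<^sub>F n in ?F. measure (M n) {\<omega> \<in> space (M n). \<forall>m\<in>{1..p}. X n \<omega> m = \<tau> m} =
        (\<Sum>\<sigma> | \<sigma> \<in> perms n \<and> (\<forall>t\<in>{1..p}. \<sigma> t = \<tau> t). P n \<sigma>)"
      using in_\<N> by eventually_elim (rule law)
    show "(\<lambda>n. \<Sum>\<sigma> | \<sigma> \<in> perms n \<and> (\<forall>t\<in>{1..p}. \<sigma> t = \<tau> t). P n \<sigma>)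
        \<sim>[?F] (\<lambda>n. 1 / real n ^ p)"
      using a by (rule iffD1[OF asymp_equiv_cong[OF e always_eventually], rotated]) simp
  qed
  have masses: "((\<lambda>n. measure (?\<mu> n) {k}) \<longlongrightarrow> measure ?\<nu> {k}) ?F" if k: "k \<in> ?\<Omega>" for k
  proof -
    have "((\<lambda>n. \<Sum>\<sigma>\<in>perms n. P n \<sigma> * (\<Prod>l\<in>K. of_bool (num_cycles n l \<sigma> = k l)))
        \<longlongrightarrow> (\<Prod>l\<in>K. exp (- (1 / real l)) * ((1 / real l) ^ k l / fact (k l)))) ?F"
      by (rule point_masses_tendsto_of_binomial_moments[OF \<open>finite K\<close> always_eventually moments])
        (simp add: P_def)
    moreover have "\<forall>\<^sub>F n in ?F. (\<Sum>\<sigma>\<in>perms n. P n \<sigma> * (\<Prod>l\<in>K. of_bool (num_cycles n l \<sigma> = k l))) =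
        measure (?\<mu> n) {k}"
      using in_\<N>
    proof eventually_elim
      case (elim n)
      have X: "X n \<in> M n \<rightarrow>\<^sub>M count_space (perms n)" using assms(5) elim by blast
      have Y: "(\<lambda>\<omega>. \<lambda>l\<in>K. num_cycles n l (X n \<omega>)) \<in> M n \<rightarrow>\<^sub>M nat_vectors K"
        unfolding vec by (rule measurable_compose[OF X]) auto
      \<comment> \<open>\<open>k\<close> is extensional, so agreement on \<open>K\<close> is
        equality of functions.\<close>
      have eq_k: "(\<lambda>l\<in>K. num_cycles n l \<sigma>) = k \<longleftrightarrow> (\<forall>l\<in>K. num_cycles n l \<sigma> = k l)" for \<sigma>
        using k by (auto simp: fun_eq_iff PiE_def extensional_def)
      have "measure (?\<mu> n) {k} =
          measure (M n) {\<omega> \<in> space (M n). \<forall>l\<in>K. num_cycles n l (X n \<omega>) = k l}"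
        using k by (subst measure_distr[OF Y])
          (auto simp: vec eq_k[symmetric] intro!: arg_cong[where f = "measure (M n)"])
      also have "\<dots> = (\<Sum>\<sigma> | \<sigma> \<in> perms n \<and> (\<forall>l\<in>K. num_cycles n l \<sigma> = k l). P n \<sigma>)"
        using elim by (rule law)
      also have "\<dots> = (\<Sum>\<sigma>\<in>perms n. P n \<sigma> * (\<Prod>l\<in>K. of_bool (num_cycles n l \<sigma> = k l)))"
        unfolding prod_of_bool[OF \<open>finite K\<close>] using finite_perms
        by (intro sum.mono_neutral_cong_left) auto
      finally show ?case by simp
    qed
    ultimately have "((\<lambda>n. measure (?\<mu> n) {k})
        \<longlongrightarrow> (\<Prod>l\<in>K. exp (- (1 / real l)) * ((1 / real l) ^ k l / fact (k l)))) ?F"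
      by (rule Lim_transform_eventually)
    \<comment> \<open>By \<open>K1\<close> each rate \<open>1 / real l\<close> is positive, and the
      factors are the Poisson masses at \<open>k l\<close>.\<close>
    also have "(\<Prod>l\<in>K. exp (- (1 / real l)) * ((1 / real l) ^ k l / fact (k l))) = measure ?\<nu> {k}"
      using k K1 by (subst measure_PiM_measure_pmf_singleton[OF \<open>finite K\<close>])
        (auto simp: PiE_def mult_ac intro!: prod.cong)
    finally show ?thesis .
  qed
  have \<mu>: "\<forall>\<^sub>F n in ?F. prob_space (?\<mu> n) \<and> sets (?\<mu> n) = Pow ?\<Omega>"
    using in_\<N>
  proof eventually_elim
    case (elim n)
    then have X: "X n \<in> M n \<rightarrow>\<^sub>M count_space (perms n)" using assms(5) by blast
    have "(\<lambda>\<omega>. \<lambda>l\<in>K. num_cycles n l (X n \<omega>)) \<in> M n \<rightarrow>\<^sub>M nat_vectors K"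
      unfolding vec by (rule measurable_compose[OF X]) auto
    then have "prob_space (?\<mu> n)"
      using assms(4) elim by (intro prob_space.prob_space_distr) auto
    then show ?case by (simp add: vec)
  qed
  have \<nu>: "prob_space ?\<nu>" "sets ?\<nu> = Pow ?\<Omega>"
  proof -
    show "prob_space ?\<nu>" by (intro prob_space_PiM prob_space_measure_pmf)
    have "sets ?\<nu> = sets (nat_vectors K)" by (intro sets_PiM_cong) auto
    then show "sets ?\<nu> = Pow ?\<Omega>" by (simp add: vec)
  qed
  have countable: "countable ?\<Omega>" using \<open>finite K\<close> by (intro countable_PiE) auto
  show ?thesis
    unfolding weakly_converges_def
  proof (intro allI impI)
    fix f :: "(nat \<Rightarrow> nat) \<Rightarrow> real"
    assume "continuous_map (nat_vectors_topology K) euclidean f \<and>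
      bounded (f ` topspace (nat_vectors_topology K))"
    then obtain B where "\<And>x. x \<in> ?\<Omega> \<Longrightarrow> \<bar>f x\<bar> \<le> B" by (auto simp: bounded_iff)
    then show "((\<lambda>n. \<integral>x. f x \<partial>?\<mu> n) \<longlongrightarrow> (\<integral>x. f x \<partial>?\<nu>)) ?F"
      by (intro tendsto_integral_discrete[OF countable \<mu> \<nu> masses])
  qed
qed

end
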